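(* Let $n\ge 1$ and let $I_n=\mathrm{diag}(0,1,\dots,1)\in\mathrm{Sym}(\mathbb R^{n+1})$. For every $A\in\mathrm{Sym}(\mathbb R^{n+1})\setminus\mathcal S$, every eigenvalue of $I_n+\sqrt{-1}A$ is nonzero and has nonnegative real part, so $\widehat\Theta(A)$ is defined; moreover the function $\widehat\Theta:\mathrm{Sym}(\mathbb R^{n+1})\setminus\mathcal S\to\mathbb R$ is differentiable. Furthermore, $\widetilde\Theta$ is the smallest upper semicontinuous function on $\mathrm{Sym}(\mathbb R^{n+1})$ that extends $\widehat\Theta$, and $\underline{\widetilde\Theta}$ is the largest lower semicontinuous function on $\mathrm{Sym}(\mathbb R^{n+1})$ that extends $\widehat\Theta$.
   Context: For $A=[a_{ij}]_{i,j=0}^n\in\mathrm{Sym}(\mathbb R^{n+1})$ write $A^+=[a_{ij}]_{i,j=1}^n\in\mathrm{Sym}(\mathbb R^n)$ and $\vec a_0=(a_{01},\dots,a_{0n})$. Let $\mathcal S=\{A\in\mathrm{Sym}(\mathbb R^{n+1}): A=\mathrm{diag}(0,A^+)\}$ (first row and column vanish). $\arg$ denotes the branch of the argument with values in $(-\pi,\pi]$, and $\tan^{-1}$ has values in $(-\pi/2,\pi/2)$; for a real symmetric matrix $M$, $\tan^{-1}M$ is defined by applying $\tan^{-1}$ to the eigenvalues. For $A\notin\mathcal S$ set $\widehat\Theta(A)=\sum_{\lambda\in\mathrm{spec}(I_n+\sqrt{-1}A)} m(\lambda)\arg(\lambda)$, where $m(\lambda)$ is the multiplicity of $\lambda$ as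 a root of the characteristic polynomial. Define $\widetilde\Theta,\underline{\widetilde\Theta}:\mathrm{Sym}(\mathbb R^{n+1})\to\mathbb R$ by $\widetilde\Theta=\underline{\widetilde\Theta}=\widehat\Theta$ off $\mathcal S$, and for $A\in\mathcal S$: $\widetilde\Theta(A)=\pi/2+\mathrm{tr}\tan^{-1}(A^+)$, $\underline{\widetilde\Theta}(A)=-\pi/2+\mathrm{tr}\tan^{-1}(A^+)$. *)

theory Defs
  imports "HOL-Analysis.Analysis" "HOL-Computational_Algebra.Polynomial"
begin

text \<open>Matrices in Sym(R^(n+1)) are indexed by the finite type 'n option:
  the index None plays the role of 0, and Some i (i :: 'n, CARD('n) = n) the indices 1..n.\<close>

definition sym_mats :: "(real^'m::finite^'m) set" where
  "sym_mats = {A. transpose A = A}"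

definition S_set :: "(real^('n::finite option)^('n option)) set" where
  "S_set = {A \<in> sym_mats. \<forall>j. A $ None $ j = 0 \<and> A $ j $ None = 0}"

definition charpoly :: "'a::comm_ring_1^'m^'m \<Rightarrow> 'a poly" where
  "charpoly M = det (\<chi> i j. (if i = j then [:0, 1:] else 0) - [:M $ i $ j:])"

definition In_mat :: "complex^('n::finite option)^('n option)" where
  "In_mat = (\<chi> i j. if i = j \<and> i \<noteq> None then 1 else 0)"

definition IA :: "real^('n::finite option)^('n option) \<Rightarrow> complex^('n::finite option)^('n option)" where
  "IA A = (\<chi> i j. In_mat $ i $ j + \<i> * complex_of_real (A $ i $ j))"

text \<open>Theta-hat: sum over the spectrum, counted with algebraic multiplicity, of Arg
  (Arg has values in (-pi, pi]).\<close>
definition Theta_hat :: "real^('n::finite option)^('n option) \<Rightarrow> real" where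
  "Theta_hat A = (\<Sum>z\<in>{w. poly (charpoly (IA A)) w = 0}.
                    real (order z (charpoly (IA A))) * Arg z)"

definition Aplus :: "real^('n::finite option)^('n option) \<Rightarrow> real^'n^'n" where
  "Aplus A = (\<chi> i j. A $ Some i $ Some j)"

definition tr_arctan :: "real^'n::finite^'n \<Rightarrow> real" where
  "tr_arctan M = (\<Sum>x\<in>{y. poly (charpoly M) y = 0}. real (order x (charpoly M)) * arctan x)"

definition Theta_tilde :: "real^('n::finite option)^('n option) \<Rightarrow> real" where
  "Theta_tilde A = (if A \<in> S_set then pi / 2 + tr_arctan (Aplus A) else Theta_hat A)"

definition Theta_tilde_low :: "real^('n::finite option)^('n option) \<Rightarrow> real" where
  "Theta_tilde_low A = (if A \<in> S_set then - pi / 2 + tr_arctan (Aplus A) else Theta_hat A)"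

definition usc_on :: "'a::topological_space set \<Rightarrow> ('a \<Rightarrow> real) \<Rightarrow> bool" where
  "usc_on U f \<longleftrightarrow> (\<forall>a. openin (top_of_set U) {x \<in> U. f x < a})"

definition lsc_on :: "'a::topological_space set \<Rightarrow> ('a \<Rightarrow> real) \<Rightarrow> bool" where
  "lsc_on U f \<longleftrightarrow> (\<forall>a. openin (top_of_set U) {x \<in> U. f x > a})"

end

theory Submission
  imports Defs "HOL-Computational_Algebra.Fundamental_Theorem_Algebra"
begin

text \<open>Pairing an eigenvector with itself shows that the spectrum of \<open>IA A\<close> lies in the closed right
  half-plane and avoids 0 unless \<open>A\<close> is in \<open>S_set\<close>, where 0 is a simple root. Hence both extensions
  are sums over the spectrum of the argument, extended to 0 by \<open>pi / 2\<close> and \<open>- pi / 2\<close>. These extended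
  arguments are upper and lower semicontinuous on the half-plane, and semicontinuity passes to
  the sums because the vectors of roots of convergent characteristic polynomials subconverge to
  a vector of roots of the limit. Off \<open>S_set\<close> the sum is thus a continuous choice of the argument of the nonzero
  polynomial \<open>det (IA A)\<close>, hence differentiable. Extremality follows by perturbing the entry at
  \<open>(None, None)\<close>, which moves the eigenvalue 0 along the imaginary axis. The lower statements are
  the upper ones for \<open>- Theta_hat\<close>, so a sign \<open>c\<close> treats both at once.\<close>

section \<open>Characteristic polynomials\<close>

lemma poly_charpoly: "poly (charpoly M) x = det (mat x - M)"
proof -
  have "poly (charpoly M) x =
      (\<Sum>p | p permutes UNIV. of_int (sign p) *
        (\<Prod>i\<in>UNIV. poly ((if i = p i then [:0, 1:] else 0) - [:M $ i $ p i:]) x))"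
    by (simp add: charpoly_def det_def poly_sum poly_prod)
  also have "\<dots> = det (mat x - M)"
    unfolding det_def by (intro sum.cong prod.cong arg_cong2[where f="(*)"] refl) (auto simp: mat_def)
  finally show ?thesis .
qed

text \<open>In the Leibniz expansion the identity contributes a monic product of
  \<open>CARD('m)\<close> linear factors. Any other permutation moves some index, which gives a
  constant factor, so its term has smaller degree.\<close>

lemma
  fixes M :: "'a::idom^'m^'m"
  shows degree_charpoly: "degree (charpoly M) = CARD('m)"
    and lead_coeff_charpoly: "lead_coeff (charpoly M) = 1"
proof -
  define e where "e i j = (if i = j then [:0, 1:] else 0) - [:M $ i $ j:]" for i j
  define t where "t p = of_int (sign p) * (\<Prod>i\<in>UNIV. e i (p i))" for p
  let ?P = "{p. p permutes (UNIV::'m set)}"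
  have e_diag: "e i i = [:- M $ i $ i, 1:]" for i
    by (simp add: e_def)
  have t_id: "t id = (\<Prod>i\<in>UNIV. [:- M $ i $ i, 1:])"
    by (simp add: t_def sign_id e_diag)
  have deg_id: "degree (t id) = CARD('m)"
    unfolding t_id by (subst degree_prod_eq_sum_degree) auto
  have lead_id: "lead_coeff (t id) = 1"
    unfolding t_id by (simp add: lead_coeff_prod)
  have deg_t: "degree (t p) < CARD('m)" if p: "p \<noteq> id" for p
  proof -
    from p obtain k where k: "p k \<noteq> k" by (auto simp: fun_eq_iff)
    have "degree (t p) \<le> degree (\<Prod>i\<in>UNIV. e i (p i))"
      unfolding t_def by (cases "sign p = 1") (auto simp: sign_def)
    also have "\<dots> \<le> (\<Sum>i\<in>UNIV. degree (e i (p i)))"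
      using degree_prod_sum_le[of UNIV "\<lambda>i. e i (p i)"] by (simp add: o_def)
    also have "\<dots> < (\<Sum>i\<in>(UNIV::'m set). 1)"
      by (rule sum_strict_mono_ex1) (use k in \<open>auto simp: e_def intro!: exI[of _ k]\<close>)
    finally show ?thesis by simp
  qed
  have "charpoly M = sum t ?P"
    by (simp add: charpoly_def det_def t_def e_def)
  also have "\<dots> = t id + sum t (?P - {id})"
    by (rule sum.remove) (auto simp: permutes_id)
  finally have eq: "charpoly M = t id + sum t (?P - {id})" .
  have "degree (sum t (?P - {id})) < CARD('m)"
    by (rule degree_sum_less) (use deg_t in auto)
  then have less: "degree (sum t (?P - {id})) < degree (t id)"
    by (simp add: deg_id)
  show "degree (charpoly M) = CARD('m)"
    using degree_add_eq_left[OF less] deg_id eq by simp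
  show "lead_coeff (charpoly M) = 1"
    using lead_coeff_add_le[OF less] lead_id eq by (simp add: add.commute)
qed

text \<open>Induction on the index set, splitting off one root at a time. Indexing the roots by a
  set of the right size later allows them to be indexed like the rows of the matrix and treated as a
  vector.\<close>

lemma monic_complex_poly_splits:
  fixes p :: "complex poly"
  assumes "finite I" "degree p = card I" "lead_coeff p = 1"
  shows "\<exists>r. p = (\<Prod>i\<in>I. [:- r i, 1:])"
  using assms
proof (induction I arbitrary: p rule: finite_induct)
  case empty
  then have "p = [:coeff p 0:]" by (metis card.empty degree_0_id)
  with empty show ?case by (simp add: one_pCons)
next
  case (insert i I)
  then have "degree p \<noteq> 0" by simp
  then obtain z where "poly p z = 0"
    using fundamental_theorem_of_algebra[of p] constant_degree[of p] by auto
  then obtain q where q: "p = [:- z, 1:] * q"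
    by (metis dvdE poly_eq_0_iff_dvd)
  have "q \<noteq> 0" using insert.prems(2) q by force
  then have "degree p = Suc (degree q)"
    unfolding q by (subst degree_mult_eq) auto
  moreover have "lead_coeff p = lead_coeff q"
    unfolding q lead_coeff_mult by simp
  ultimately obtain r where r: "q = (\<Prod>i\<in>I. [:- r i, 1:])"
    using insert by fastforce
  have "(\<Prod>j\<in>I. [:- r j, 1:]) = (\<Prod>j\<in>I. [:- (r(i := z)) j, 1:])"
    using insert.hyps by (intro prod.cong) auto
  then have "p = (\<Prod>j\<in>insert i I. [:- (r(i := z)) j, 1:])"
    unfolding q r prod.insert[OF insert.hyps] by simp
  then show ?case by blast
qed

lemma charpoly_splits:
  fixes M :: "complex^'m^'m"
  obtains r :: "'m \<Rightarrow> complex" where "charpoly M = (\<Prod>i\<in>UNIV. [:- r i, 1:])"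
  using monic_complex_poly_splits[of UNIV "charpoly M"] degree_charpoly lead_coeff_charpoly
  by (metis finite)

text \<open>Common shape of \<open>Theta_hat\<close> and \<open>tr_arctan\<close>. Keeping
  \<open>f\<close> free makes it possible to change the value assigned to the eigenvalue 0.\<close>

definition spectral_sum :: "('a::idom \<Rightarrow> real) \<Rightarrow> 'a^'m^'m \<Rightarrow> real" where
  "spectral_sum f M = (\<Sum>z | poly (charpoly M) z = 0. real (order z (charpoly M)) * f z)"

lemma order_prod_linear_factors:
  fixes r :: "'i \<Rightarrow> 'a::idom"
  assumes "finite I"
  shows "order z (\<Prod>i\<in>I. [:- r i, 1:]) = card {i\<in>I. r i = z}"
  using assms
proof (induction I rule: finite_induct)
  case empty
  show ?case by (simp add: order_0I)
next
  case (insert i I)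
  have nz: "[:- r i, 1:] * (\<Prod>i\<in>I. [:- r i, 1:]) \<noteq> 0"
    unfolding mult_eq_0_iff using insert.hyps(1) by simp
  have 1: "order z [:- r i, 1:] = (if r i = z then 1 else 0)"
    using order_power_n_n[of "r i" 1] by (auto intro: order_0I)
  have 2: "{j \<in> insert i I. r j = z} = (if r i = z then insert i {j\<in>I. r j = z} else {j\<in>I. r j = z})"
    by auto
  have "order z (\<Prod>i\<in>insert i I. [:- r i, 1:]) = order z ([:- r i, 1:] * (\<Prod>i\<in>I. [:- r i, 1:]))"
    using insert.hyps by simp
  also have "\<dots> = order z [:- r i, 1:] + order z (\<Prod>i\<in>I. [:- r i, 1:])"
    by (rule order_mult[OF nz])
  also have "\<dots> = card {j \<in> insert i I. r j = z}"
    unfolding 2 using insert.hyps by (simp add: insert.IH 1)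
  finally show ?case .
qed

text \<open>Grouping the indices by the value of \<open>r\<close> turns multiplicities into
  cardinalities of fibres.\<close>

lemma spectral_sum_eq:
  fixes M :: "'a::idom^'m^'m" and r :: "'i::finite \<Rightarrow> 'a"
  assumes M: "charpoly M = (\<Prod>i\<in>UNIV. [:- r i, 1:])"
  shows "spectral_sum f M = (\<Sum>i\<in>UNIV. f (r i))"
proof -
  have roots: "{z. poly (charpoly M) z = 0} = range r"
    by (auto simp: M poly_prod)
  have "spectral_sum f M = (\<Sum>z\<in>range r. real (card {i. r i = z}) * f z)"
    unfolding spectral_sum_def roots by (simp add: M order_prod_linear_factors)
  also have "\<dots> = (\<Sum>z\<in>range r. \<Sum>i\<in>{i\<in>UNIV. r i = z}. f (r i))"
    by (intro sum.cong refl) simp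
  also have "\<dots> = (\<Sum>i\<in>UNIV. f (r i))"
    by (rule sum.group) auto
  finally show ?thesis .
qed

lemma charpoly_root_eigenvector:
  fixes M :: "'a::field^'m^'m"
  assumes "poly (charpoly M) z = 0"
  obtains v where "v \<noteq> 0" "M *v v = z *s v"
proof -
  have "\<not> invertible (mat z - M)"
    using assms by (simp add: poly_charpoly invertible_det_nz)
  then obtain v where v: "v \<noteq> 0" "(mat z - M) *v v = 0"
    using invertible_left_inverse matrix_left_invertible_ker by blast
  have "mat z *v v = z *s v"
    by (simp add: vec_eq_iff matrix_vector_mult_def mat_def if_distrib[where f="\<lambda>x. x * _"] cong: if_cong)
  with v have "M *v v = z *s v"
    by (simp add: matrix_vector_mult_diff_rdistrib)
  with v(1) show ?thesis by (rule that)
qed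

text \<open>Compare both sides of the eigenvalue equation in a row where the eigenvector has an
  entry of maximal modulus. The bound keeps the roots of a convergent sequence of matrices in a
  compact set.\<close>

lemma charpoly_root_norm_le:
  fixes M :: "complex^'m^'m"
  assumes "poly (charpoly M) z = 0"
  shows "norm z \<le> (\<Sum>i\<in>UNIV. \<Sum>j\<in>UNIV. norm (M $ i $ j))"
proof -
  obtain v where v: "v \<noteq> 0" "M *v v = z *s v"
    using charpoly_root_eigenvector[OF assms] .
  define m where "m = Max (range (\<lambda>i. norm (v $ i)))"
  have le_m: "norm (v $ j) \<le> m" for j
    unfolding m_def by (rule Max_ge) auto
  have "m \<in> range (\<lambda>i. norm (v $ i))"
    unfolding m_def by (rule Max_in) auto
  then obtain i where i: "norm (v $ i) = m" by auto
  obtain k where "v $ k \<noteq> 0" using v(1) by (auto simp: vec_eq_iff)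
  then have "0 < norm (v $ k)" by simp
  also note le_m[of k]
  finally have "m > 0" .
  have "norm z * m = norm ((M *v v) $ i)"
    by (simp add: v(2) norm_mult i)
  also have "\<dots> \<le> (\<Sum>j\<in>UNIV. norm (M $ i $ j * v $ j))"
    by (simp add: matrix_vector_mult_def norm_sum)
  also have "\<dots> \<le> (\<Sum>j\<in>UNIV. norm (M $ i $ j) * m)"
    by (intro sum_mono) (simp add: norm_mult mult_left_mono le_m)
  also have "\<dots> = (\<Sum>j\<in>UNIV. norm (M $ i $ j)) * m"
    by (simp add: sum_distrib_right)
  finally have "norm z \<le> (\<Sum>j\<in>UNIV. norm (M $ i $ j))"
    using \<open>m > 0\<close> by simp
  also have "\<dots> \<le> (\<Sum>i\<in>UNIV. \<Sum>j\<in>UNIV. norm (M $ i $ j))"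
    by (rule member_le_sum[of i UNIV "\<lambda>i. \<Sum>j\<in>UNIV. norm (M $ i $ j)"]) (auto intro: sum_nonneg)
  finally show ?thesis .
qed

text \<open>Only permutations fixing \<open>None\<close> contribute to the expansion. They are
  exactly the extensions of permutations of \<open>'n\<close>, and extending preserves the
  sign.\<close>

lemma det_option_block:
  fixes M :: "'a::comm_ring_1^('n::finite option)^('n option)"
  assumes "\<And>j. M $ None $ Some j = 0"
  shows "det M = M $ None $ None * det (\<chi> i j. M $ Some i $ Some j)"
proof -
  let ?t = "\<lambda>p. of_int (sign p) * (\<Prod>i\<in>UNIV. M $ i $ p i)"
  let ?F = "map_permutation UNIV Some :: ('n \<Rightarrow> 'n) \<Rightarrow> _"
  have zero: "?t p = 0" if "p None \<noteq> None" for p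
  proof -
    have "M $ None $ p None = 0" using that assms by (cases "p None") auto
    then have "(\<Prod>i\<in>UNIV. M $ i $ p i) = 0" by (meson UNIV_I finite prod_zero)
    then show ?thesis by simp
  qed
  have F_Some: "?F q (Some i) = Some (q i)" for q i
    by (rule map_permutation_apply) auto
  have F_None: "?F q None = None" for q
    by (simp add: map_permutation_def restrict_id_def)
  have bij: "bij_betw ?F {q. q permutes UNIV} {p. p permutes UNIV \<and> p None = None}"
    (is "bij_betw _ ?Q ?P")
  proof (rule bij_betwI')
    show "(?F q = ?F q') = (q = q')" for q q'
      by (metis F_Some ext option.inject)
    show "?F q \<in> ?P" if "q \<in> ?Q" for q
    proof -
      have "?F q permutes range Some"
        by (rule map_permutation_permutes) (use that in \<open>auto simp: bij_betw_def\<close>)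
      then show ?thesis by (auto simp: F_None intro: permutes_subset)
    qed
    show "\<exists>q\<in>?Q. p = ?F q" if p: "p \<in> ?P" for p
    proof -
      have bp: "bij p" and pN: "p None = None" using p by (auto simp: permutes_bij)
      have ne: "p (Some i) \<noteq> None" for i
        using bp pN by (metis bij_pointE option.distinct(1))
      \<comment> \<open>The junk value of \<open>the\<close> never occurs: \<open>None\<close> is
        already the image of \<open>None\<close>, so injectivity excludes it here.\<close>
      define q where "q = (\<lambda>i. the (p (Some i)))"
      have q: "p (Some i) = Some (q i)" for i
        using ne by (simp add: q_def)
      have "inj q"
        by (rule injI) (metis q bp bij_is_inj injD option.inject)
      then have "q permutes UNIV"
        by (intro inj_imp_permutes) auto
      moreover have "p = ?F q"
      proof
        show "p x = ?F q x" for x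
          by (cases x) (simp_all add: pN q F_None F_Some)
      qed
      ultimately show ?thesis by blast
    qed
  qed
  have UNIV: "(UNIV :: 'n option set) = insert None (range Some)"
    by (simp add: UNIV_option_conv)
  have "det M = (\<Sum>p\<in>?P. ?t p)"
    unfolding det_def by (rule sum.mono_neutral_right) (use zero in auto)
  also have "\<dots> = (\<Sum>q\<in>?Q. ?t (?F q))"
    by (rule sum.reindex_bij_betw[OF bij, symmetric])
  also have "\<dots> = (\<Sum>q\<in>?Q. M $ None $ None * (of_int (sign q) * (\<Prod>i\<in>UNIV. M $ Some i $ Some (q i))))"
  proof (rule sum.cong)
    fix q assume "q \<in> ?Q"
    then have "sign (?F q) = sign q"
      by (intro sign_map_permutation) auto
    then show "?t (?F q) = M $ None $ None * (of_int (sign q) * (\<Prod>i\<in>UNIV. M $ Some i $ Some (q i)))"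
      by (simp add: UNIV prod.reindex F_None F_Some)
  qed simp
  also have "\<dots> = M $ None $ None * det (\<chi> i j. M $ Some i $ Some j)"
    by (simp add: det_def sum_distrib_left)
  finally show ?thesis .
qed


section \<open>Semicontinuity of sums over the spectrum\<close>

text \<open>If the sublevel set is not a relative neighbourhood of \<open>x\<close>, some sequence
  tends to \<open>x\<close> with every value at least \<open>a\<close>. Hence a single index with a
  smaller value suffices, which leaves room for passing to subsequences.\<close>

lemma usc_onI_sequentially:
  fixes f :: "'a::metric_space \<Rightarrow> real"
  assumes "\<And>x X a. x \<in> U \<Longrightarrow> (\<And>k. X k \<in> U) \<Longrightarrow> X \<longlonglongrightarrow> x \<Longrightarrow> f x < a \<Longrightarrow> \<exists>k. f (X k) < a"
  shows "usc_on U f"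
  unfolding usc_on_def
proof
  fix a
  have "\<exists>e>0. ball x e \<inter> U \<subseteq> {x \<in> U. f x < a}" if x: "x \<in> U" "f x < a" for x
  proof (rule ccontr)
    assume neg: "\<not> (\<exists>e>0. ball x e \<inter> U \<subseteq> {x \<in> U. f x < a})"
    have "\<exists>y. y \<in> U \<and> dist x y < inverse (real (Suc k)) \<and> \<not> f y < a" for k
    proof -
      have "\<not> ball x (inverse (real (Suc k))) \<inter> U \<subseteq> {x \<in> U. f x < a}"
        using neg by (metis inverse_positive_iff_positive of_nat_0_less_iff zero_less_Suc)
      then show ?thesis by auto
    qed
    then obtain X where X: "\<And>k. X k \<in> U" "\<And>k. dist x (X k) < inverse (real (Suc k))"
        "\<And>k. \<not> f (X k) < a"
      by metis
    have "(\<lambda>k. dist (X k) x) \<longlonglongrightarrow> 0"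
      by (rule tendsto_sandwich[OF _ _ tendsto_const LIMSEQ_inverse_real_of_nat])
        (auto intro!: eventuallyI less_imp_le X(2) simp: dist_commute[of _ x] simp del: of_nat_Suc)
    then have "X \<longlonglongrightarrow> x" by (rule iffD2[OF tendsto_dist_iff])
    with assms x X show False by blast
  qed
  then show "openin (top_of_set U) {x \<in> U. f x < a}"
    unfolding openin_contains_ball by auto
qed

lemma usc_on_eventually_at:
  assumes "usc_on U f" "x \<in> U" "f x < a"
  shows "\<forall>\<^sub>F y in at x within U. f y < a"
proof -
  obtain T where T: "open T" "{x \<in> U. f x < a} = U \<inter> T"
    using assms(1) unfolding usc_on_def openin_open by blast
  then show ?thesis
    using assms(2,3) unfolding eventually_at_topological by blast
qed

lemma usc_on_eventually_sequentially:
  assumes "usc_on U f" "x \<in> U" "f x < a" "X \<longlonglongrightarrow> x" "\<And>k. X k \<in> U"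
  shows "\<forall>\<^sub>F k in sequentially. f (X k) < a"
proof -
  obtain T where T: "open T" "{x \<in> U. f x < a} = U \<inter> T"
    using assms(1) unfolding usc_on_def openin_open by blast
  then have "\<forall>\<^sub>F k in sequentially. X k \<in> T"
    using assms(2-4) by (intro topological_tendstoD) auto
  then show ?thesis
    by eventually_elim (use T assms(5) in auto)
qed

lemma usc_on_cong:
  assumes "\<And>x. x \<in> U \<Longrightarrow> f x = g x"
  shows "usc_on U f \<longleftrightarrow> usc_on U g"
proof -
  have "{x \<in> U. f x < a} = {x \<in> U. g x < a}" for a
    using assms by auto
  then show ?thesis by (simp only: usc_on_def)
qed

lemma lsc_on_iff_usc_on_minus: "lsc_on U f \<longleftrightarrow> usc_on U (\<lambda>x. - f x)"
proof -
  have "{x \<in> U. - f x < a} = {x \<in> U. f x > - a}" for a by auto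
  then show ?thesis
    unfolding lsc_on_def usc_on_def by (metis minus_minus)
qed

lemma tendsto_det:
  fixes M :: "'a \<Rightarrow> 'b::{real_normed_field}^'m^'m"
  assumes "(M \<longlongrightarrow> L) F"
  shows "((\<lambda>x. det (M x)) \<longlongrightarrow> det L) F"
  unfolding det_def
  by (intro tendsto_sum tendsto_mult tendsto_const tendsto_prod tendsto_vec_nth assms)

text \<open>No continuous labelling of the roots is needed: along a subsequence the root vectors
  converge, their limit lists the roots of the limit matrix, and semicontinuity of \<open>g\<close>
  applies to each coordinate.\<close>

lemma usc_on_spectral_sum:
  fixes \<Phi> :: "'a::metric_space \<Rightarrow> complex^'m^'m"
  assumes g: "usc_on H g" and \<Phi>: "continuous_on U \<Phi>"
    and roots: "\<And>x z. x \<in> U \<Longrightarrow> poly (charpoly (\<Phi> x)) z = 0 \<Longrightarrow> z \<in> H"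
  shows "usc_on U (\<lambda>x. spectral_sum g (\<Phi> x))"
proof (rule usc_onI_sequentially)
  fix x X a
  assume x: "x \<in> U" and X: "\<And>k. X k \<in> U" "X \<longlonglongrightarrow> x" and a: "spectral_sum g (\<Phi> x) < a"
  have lim: "(\<lambda>k. \<Phi> (X k)) \<longlonglongrightarrow> \<Phi> x"
    using \<Phi> x X unfolding continuous_on_sequentially by (auto simp: o_def)
  \<comment> \<open>The roots are packed into one vector so that boundedness yields a subsequence
    along which all of them converge.\<close>
  have "\<exists>R::complex^'m. charpoly (\<Phi> (X k)) = (\<Prod>i\<in>UNIV. [:- R $ i, 1:])" for k
  proof -
    obtain r :: "'m \<Rightarrow> complex" where "charpoly (\<Phi> (X k)) = (\<Prod>i\<in>UNIV. [:- r i, 1:])"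
      using charpoly_splits .
    then show ?thesis by (intro exI[of _ "\<chi> i. r i"]) simp
  qed
  then obtain R :: "nat \<Rightarrow> complex^'m"
    where R: "\<And>k. charpoly (\<Phi> (X k)) = (\<Prod>i\<in>UNIV. [:- R k $ i, 1:])"
    by metis
  have root: "poly (charpoly (\<Phi> (X k))) (R k $ i) = 0" for k i
    by (auto simp: R poly_prod)
  define b where "b k = (\<Sum>i\<in>UNIV. \<Sum>j\<in>UNIV. norm (\<Phi> (X k) $ i $ j))" for k
  have "b \<longlonglongrightarrow> (\<Sum>i\<in>UNIV. \<Sum>j\<in>UNIV. norm (\<Phi> x $ i $ j))"
    unfolding b_def by (intro tendsto_sum tendsto_norm tendsto_vec_nth lim)
  then have "Bseq b" by (rule convergent_imp_Bseq[OF convergentI])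
  then obtain K where K: "\<And>k. norm (b k) \<le> K" by (auto simp: Bseq_def)
  have "norm (R k) \<le> real CARD('m) * K" for k
  proof -
    have "norm (R k) \<le> (\<Sum>i\<in>UNIV. norm (R k $ i))"
      unfolding norm_vec_def by (rule L2_set_le_sum) auto
    also have "\<dots> \<le> (\<Sum>i\<in>(UNIV::'m set). K)"
    proof (rule sum_mono)
      fix i
      have "norm (R k $ i) \<le> b k"
        unfolding b_def by (rule charpoly_root_norm_le[OF root])
      with K[of k] show "norm (R k $ i) \<le> K" by simp
    qed
    finally show ?thesis by simp
  qed
  then have "bounded (range R)" by (auto simp: bounded_iff)
  then obtain l \<sigma> where \<sigma>: "strict_mono \<sigma>" and l: "(R \<circ> \<sigma>) \<longlonglongrightarrow> l"
    using bounded_imp_convergent_subsequence by blast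
  have l_i: "(\<lambda>k. R (\<sigma> k) $ i) \<longlonglongrightarrow> l $ i" for i
    using tendsto_vec_nth[OF l, of i] by (simp add: o_def)
  have lim': "(\<lambda>k. \<Phi> (X (\<sigma> k))) \<longlonglongrightarrow> \<Phi> x"
    using LIMSEQ_subseq_LIMSEQ[OF lim \<sigma>] by (simp add: o_def)
  \<comment> \<open>Both sides are limits of the same values at \<open>y\<close>, one through the
    determinant and one through the factorization.\<close>
  have "poly (charpoly (\<Phi> x)) y = poly (\<Prod>i\<in>UNIV. [:- l $ i, 1:]) y" for y
  proof (rule LIMSEQ_unique)
    show "(\<lambda>k. poly (charpoly (\<Phi> (X (\<sigma> k)))) y) \<longlonglongrightarrow> poly (charpoly (\<Phi> x)) y"
      unfolding poly_charpoly by (intro tendsto_det tendsto_diff tendsto_const lim')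
    have "(\<lambda>k. \<Prod>i\<in>UNIV. (y - R (\<sigma> k) $ i)) \<longlonglongrightarrow> (\<Prod>i\<in>UNIV. (y - l $ i))"
      by (intro tendsto_prod tendsto_diff tendsto_const l_i)
    then show "(\<lambda>k. poly (charpoly (\<Phi> (X (\<sigma> k)))) y) \<longlonglongrightarrow> poly (\<Prod>i\<in>UNIV. [:- l $ i, 1:]) y"
      by (simp add: R poly_prod)
  qed
  then have L: "charpoly (\<Phi> x) = (\<Prod>i\<in>UNIV. [:- l $ i, 1:])"
    using poly_eq_poly_eq_iff by blast
  then have lH: "l $ i \<in> H" for i
    by (intro roots[OF x]) (auto simp: poly_prod)
  \<comment> \<open>The slack below \<open>a\<close> is shared equally among the roots, so that the
    errors add up to exactly that slack.\<close>
  define e where "e = (a - (\<Sum>i\<in>UNIV. g (l $ i))) / real CARD('m)"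
  have "e > 0"
    using a by (simp add: e_def spectral_sum_eq[OF L])
  have "\<forall>\<^sub>F k in sequentially. \<forall>i. g (R (\<sigma> k) $ i) < g (l $ i) + e"
  proof (rule eventually_all_finite)
    show "\<forall>\<^sub>F k in sequentially. g (R (\<sigma> k) $ i) < g (l $ i) + e" for i
      by (rule usc_on_eventually_sequentially[OF g lH _ l_i])
        (use \<open>e > 0\<close> in \<open>auto intro: roots[OF X(1) root]\<close>)
  qed
  then obtain k where k: "\<And>i. g (R (\<sigma> k) $ i) < g (l $ i) + e"
    using eventually_happens'[OF sequentially_bot] by blast
  have "spectral_sum g (\<Phi> (X (\<sigma> k))) = (\<Sum>i\<in>UNIV. g (R (\<sigma> k) $ i))"
    by (rule spectral_sum_eq[OF R])
  also have "\<dots> < (\<Sum>i\<in>UNIV. g (l $ i) + e)"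
    by (rule sum_strict_mono) (auto intro: k)
  also have "\<dots> = a" by (simp add: sum.distrib e_def)
  finally show "\<exists>k. spectral_sum g (\<Phi> (X k)) < a" by blast
qed

lemma not_nonpos_Reals_if_Re_nonneg: "0 \<le> Re z \<Longrightarrow> z \<noteq> 0 \<Longrightarrow> z \<notin> \<real>\<^sub>\<le>\<^sub>0"
  by (auto simp: complex_nonpos_Reals_iff complex_eq_iff)

text \<open>On the closed right half-plane the argument has modulus at most \<open>pi / 2\<close>,
  so this value at 0 dominates all nearby ones for either sign. Away from 0 the half-plane avoids
  the branch cut.\<close>

lemma usc_on_Arg:
  assumes c: "c = 1 \<or> c = - 1"
  shows "usc_on {z. 0 \<le> Re z} (\<lambda>z. if z = 0 then pi / 2 else c * Arg z)"
proof (rule usc_onI_sequentially)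
  fix x X a
  assume x: "x \<in> {z. 0 \<le> Re z}" and X: "\<And>k. X k \<in> {z. 0 \<le> Re z}" "X \<longlonglongrightarrow> x"
    and a: "(if x = 0 then pi / 2 else c * Arg x) < a"
  show "\<exists>k. (if X k = 0 then pi / 2 else c * Arg (X k)) < a"
  proof (cases "x = 0")
    case True
    have "\<bar>Arg (X 0)\<bar> \<le> pi / 2" using X(1)[of 0] unfolding Arg_Re_nonneg by simp
    then have "c * Arg (X 0) \<le> pi / 2" using c by auto
    then show ?thesis using a True by (intro exI[of _ 0]) auto
  next
    case False
    then have "x \<notin> \<real>\<^sub>\<le>\<^sub>0" using x not_nonpos_Reals_if_Re_nonneg by simp
    then have "(\<lambda>k. c * Arg (X k)) \<longlonglongrightarrow> c * Arg x"
      by (intro tendsto_mult tendsto_const isCont_tendsto_compose[OF continuous_at_Arg] X(2))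
    then have "\<forall>\<^sub>F k in sequentially. c * Arg (X k) < a"
      by (rule order_tendstoD(2)) (use a False in simp)
    moreover have "\<forall>\<^sub>F k in sequentially. X k \<noteq> 0"
      by (rule tendsto_imp_eventually_ne[OF X(2) False])
    ultimately have "\<forall>\<^sub>F k in sequentially. (if X k = 0 then pi / 2 else c * Arg (X k)) < a"
      by eventually_elim auto
    then show ?thesis using eventually_happens'[OF sequentially_bot] by blast
  qed
qed


section \<open>The spectrum of a diagonal matrix plus i times a symmetric matrix\<close>

text \<open>A free diagonal \<open>d\<close> covers both \<open>IA A\<close> and the identity plus
  \<open>\<i>\<close> times a symmetric matrix, the block left after removing index
  \<open>None\<close>.\<close>

definition diag_plus_i :: "('m \<Rightarrow> real) \<Rightarrow> real^'m^'m \<Rightarrow> complex^'m^'m" where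
  "diag_plus_i d A = (\<chi> i j. (if i = j then of_real (d i) else 0) + \<i> * of_real (A $ i $ j))"

lemma IA_eq_diag_plus_i: "IA A = diag_plus_i (\<lambda>i. if i = None then 0 else 1) A"
  by (auto simp: IA_def diag_plus_i_def In_mat_def vec_eq_iff)

lemma sym_mats_nth: "A \<in> sym_mats \<Longrightarrow> A $ i $ j = A $ j $ i"
  by (auto simp: sym_mats_def transpose_def vec_eq_iff)

text \<open>Pairing the eigenvalue equation with the eigenvector, the symmetric part contributes
  a purely imaginary number.\<close>

lemma Re_eigenvalue_diag_plus_i:
  assumes A: "A \<in> sym_mats" and v: "diag_plus_i d A *v v = z *s v"
  shows "Re z * (\<Sum>i\<in>UNIV. (norm (v $ i))\<^sup>2) = (\<Sum>i\<in>UNIV. d i * (norm (v $ i))\<^sup>2)"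
proof -
  define Q where "Q = (\<Sum>i\<in>UNIV. \<Sum>j\<in>UNIV. cnj (v $ i) * of_real (A $ i $ j) * v $ j)"
  have conj_term: "cnj (cnj (v $ i) * of_real (A $ i $ j) * v $ j) = cnj (v $ j) * of_real (A $ j $ i) * v $ i" for i j
    using sym_mats_nth[OF A, of i j] by simp
  \<comment> \<open>By symmetry of \<open>A\<close>, conjugation only exchanges the two summation
    indices, so \<open>Q\<close> is real.\<close>
  have "cnj Q = (\<Sum>i\<in>UNIV. \<Sum>j\<in>UNIV. cnj (v $ j) * of_real (A $ j $ i) * v $ i)"
    by (simp only: Q_def cnj_sum conj_term)
  also have "\<dots> = Q"
    unfolding Q_def by (rule sum.swap)
  finally have "Im Q = 0" by (simp add: complex_eq_iff)
  have sq: "cnj w * (c * w) = c * of_real ((norm w)\<^sup>2)" for c w :: complex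
    by (simp add: complex_norm_square mult_ac del: of_real_power)
  have row: "(diag_plus_i d A *v v) $ i = of_real (d i) * v $ i + \<i> * (\<Sum>j\<in>UNIV. of_real (A $ i $ j) * v $ j)" for i
  proof -
    have "(diag_plus_i d A *v v) $ i
        = (\<Sum>j\<in>UNIV. (if i = j then of_real (d i) * v $ j else 0) + \<i> * (of_real (A $ i $ j) * v $ j))"
      unfolding matrix_vector_mult_def diag_plus_i_def by (auto intro!: sum.cong simp: algebra_simps)
    then show ?thesis by (simp add: sum.distrib sum_distrib_left)
  qed
  have "z * of_real (\<Sum>i\<in>UNIV. (norm (v $ i))\<^sup>2) = (\<Sum>i\<in>UNIV. cnj (v $ i) * (z * v $ i))"
    by (simp add: sq sum_distrib_left)
  also have "\<dots> = (\<Sum>i\<in>UNIV. cnj (v $ i) * ((diag_plus_i d A *v v) $ i))"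
    by (simp add: v)
  also have "\<dots> = (\<Sum>i\<in>UNIV. of_real (d i) * of_real ((norm (v $ i))\<^sup>2)
      + \<i> * (\<Sum>j\<in>UNIV. cnj (v $ i) * of_real (A $ i $ j) * v $ j))"
    unfolding row distrib_left sq by (simp add: sum_distrib_left mult.assoc mult.left_commute[of _ \<i>])
  also have "\<dots> = of_real (\<Sum>i\<in>UNIV. d i * (norm (v $ i))\<^sup>2) + \<i> * Q"
    unfolding Q_def by (simp add: sum.distrib sum_distrib_left)
  finally have "Re (z * of_real (\<Sum>i\<in>UNIV. (norm (v $ i))\<^sup>2))
      = Re (of_real (\<Sum>i\<in>UNIV. d i * (norm (v $ i))\<^sup>2) + \<i> * Q)"
    by (rule arg_cong)
  then show ?thesis using \<open>Im Q = 0\<close> by simp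
qed

lemma sum_norm_square_pos:
  fixes v :: "complex^'m"
  assumes "v \<noteq> 0"
  shows "0 < (\<Sum>i\<in>UNIV. (norm (v $ i))\<^sup>2)"
proof -
  obtain k where "v $ k \<noteq> 0" using assms by (auto simp: vec_eq_iff)
  then show ?thesis by (intro sum_pos2[of _ k]) auto
qed

text \<open>\<open>Re z\<close> is a weighted mean of the diagonal entries 0 and 1. If it vanishes,
  the eigenvector is supported at \<open>None\<close>; an eigenvalue 0 then annihilates column
  \<open>None\<close> of \<open>A\<close>, and symmetry puts \<open>A\<close> in
  \<open>S_set\<close>.\<close>

lemma charpoly_IA_root:
  assumes A: "A \<in> sym_mats" and z: "poly (charpoly (IA A)) z = 0"
  shows "0 \<le> Re z" and "A \<notin> S_set \<Longrightarrow> z \<noteq> 0"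
proof -
  let ?d = "\<lambda>i. if i = None then 0 else 1 :: real"
  obtain v where v: "v \<noteq> 0" "IA A *v v = z *s v"
    using charpoly_root_eigenvector[OF z] .
  note eq = Re_eigenvalue_diag_plus_i[OF A v(2)[unfolded IA_eq_diag_plus_i]]
  have nonneg: "0 \<le> (\<Sum>i\<in>UNIV. ?d i * (norm (v $ i))\<^sup>2)"
    by (intro sum_nonneg) auto
  show "0 \<le> Re z"
    using nonneg[folded eq] sum_norm_square_pos[OF v(1)] by (meson mult_neg_pos not_le)
  assume S: "A \<notin> S_set"
  show "z \<noteq> 0"
  proof
    assume "z = 0"
    then have "(\<Sum>i\<in>UNIV. ?d i * (norm (v $ i))\<^sup>2) = 0" using eq by simp
    then have dv: "?d i * (norm (v $ i))\<^sup>2 = 0" for i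
      by (subst (asm) sum_nonneg_eq_0_iff) auto
    then have v_Some: "v $ Some i = 0" for i
      using dv[of "Some i"] by simp
    have v_None: "v $ None \<noteq> 0"
      using v(1) v_Some by (auto simp: vec_eq_iff split_option_all)
    have "A $ i $ None = 0" for i
    proof -
      have "(\<Sum>j\<in>UNIV. IA A $ i $ j * v $ j) = 0"
        using v(2) \<open>z = 0\<close> by (simp add: matrix_vector_mult_def vec_eq_iff)
      then have "IA A $ i $ None * v $ None = 0"
        by (simp add: UNIV_option_conv sum.reindex v_Some)
      then show ?thesis
        using v_None by (cases i) (simp_all add: IA_def In_mat_def)
    qed
    then show False
      using S A sym_mats_nth[OF A] by (auto simp: S_set_def)
  qed
qed

text \<open>All weights are 1, so every eigenvalue has real part 1. The imaginary parts are then
  identified as the roots for \<open>B\<close> by comparing characteristic polynomials, without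
  diagonalizing \<open>B\<close>.\<close>

lemma charpoly_one_plus_i:
  fixes B :: "real^'n^'n"
  assumes B: "B \<in> sym_mats"
  obtains \<mu> :: "'n \<Rightarrow> real"
  where "charpoly B = (\<Prod>i\<in>UNIV. [:- \<mu> i, 1:])"
    and "charpoly (diag_plus_i (\<lambda>_. 1) B) = (\<Prod>i\<in>UNIV. [:- (1 + \<i> * of_real (\<mu> i)), 1:])"
proof -
  let ?M = "diag_plus_i (\<lambda>_. 1) B"
  obtain r :: "'n \<Rightarrow> complex" where r: "charpoly ?M = (\<Prod>i\<in>UNIV. [:- r i, 1:])"
    using charpoly_splits .
  define \<mu> where "\<mu> i = Im (r i)" for i
  have "Re (r i) = 1" for i
  proof -
    have "poly (charpoly ?M) (r i) = 0" by (auto simp: r poly_prod)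
    then obtain v where v: "v \<noteq> 0" "?M *v v = r i *s v"
      using charpoly_root_eigenvector by blast
    show ?thesis
      using Re_eigenvalue_diag_plus_i[OF B v(2)] sum_norm_square_pos[OF v(1)] by simp
  qed
  then have r_eq: "r = (\<lambda>i. 1 + \<i> * of_real (\<mu> i))"
    by (auto simp: \<mu>_def complex_eq_iff)
  have "poly (charpoly B) y = poly (\<Prod>i\<in>UNIV. [:- \<mu> i, 1:]) y" for y
  proof -
    \<comment> \<open>At the point \<open>1 + \<i> * of_real y\<close> the identity parts cancel,
      leaving \<open>\<i>\<close> times \<open>mat y - B\<close>; each row gives a factor
      \<open>\<i>\<close>.\<close>
    have rows: "mat (1 + \<i> * of_real y) - ?M = (\<chi> k. \<i> *s (\<chi> l. of_real ((mat y - B) $ k $ l)))"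
      by (auto simp: vec_eq_iff diag_plus_i_def mat_def algebra_simps)
    have of_real_det: "det (\<chi> k l. of_real ((mat y - B) $ k $ l)) = complex_of_real (det (mat y - B))"
      by (simp add: det_def)
    have "poly (charpoly ?M) (1 + \<i> * of_real y) = \<i> ^ CARD('n) * of_real (det (mat y - B))"
      unfolding poly_charpoly rows det_rows_mul of_real_det by simp
    moreover have "poly (charpoly ?M) (1 + \<i> * of_real y) = (\<Prod>i\<in>UNIV. \<i> * of_real (y - \<mu> i))"
      unfolding r r_eq poly_prod by (intro prod.cong) (auto simp: algebra_simps)
    moreover have "\<dots> = \<i> ^ CARD('n) * of_real (\<Prod>i\<in>UNIV. (y - \<mu> i))"
      by (simp add: prod.distrib)
    ultimately have "complex_of_real (det (mat y - B)) = of_real (\<Prod>i\<in>UNIV. (y - \<mu> i))"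
      by simp
    then have "det (mat y - B) = (\<Prod>i\<in>UNIV. (y - \<mu> i))"
      by (simp only: of_real_eq_iff)
    then show ?thesis by (simp add: poly_charpoly poly_prod)
  qed
  then have "charpoly B = (\<Prod>i\<in>UNIV. [:- \<mu> i, 1:])"
    using poly_eq_poly_eq_iff by blast
  then show ?thesis using r unfolding r_eq by (rule that)
qed

text \<open>Index \<open>None\<close> splits off as a block of size one. Its entry stays arbitrary,
  so the formula serves both members of \<open>S_set\<close> and their perturbations in that
  entry.\<close>

lemma spectral_sum_IA_block:
  fixes A :: "real^('n::finite option)^('n option)"
  assumes A: "A \<in> sym_mats" and zero: "\<And>j. A $ None $ Some j = 0"
    and f: "\<And>y. f (1 + \<i> * of_real y) = c * arctan y"
  shows "spectral_sum f (IA A) = f (\<i> * of_real (A $ None $ None)) + c * tr_arctan (Aplus A)"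
proof -
  have "Aplus A \<in> sym_mats"
    using sym_mats_nth[OF A] by (auto simp: sym_mats_def transpose_def Aplus_def vec_eq_iff)
  then obtain \<mu> :: "'n \<Rightarrow> real" where \<mu>: "charpoly (Aplus A) = (\<Prod>i\<in>UNIV. [:- \<mu> i, 1:])"
    "charpoly (diag_plus_i (\<lambda>_. 1) (Aplus A)) = (\<Prod>i\<in>UNIV. [:- (1 + \<i> * of_real (\<mu> i)), 1:])"
    using charpoly_one_plus_i by blast
  define s where "s k = (case k of None \<Rightarrow> \<i> * of_real (A $ None $ None)
    | Some i \<Rightarrow> 1 + \<i> * of_real (\<mu> i))" for k
  have "poly (charpoly (IA A)) x = poly (\<Prod>k\<in>UNIV. [:- s k, 1:]) x" for x
  proof -
    have minor: "(\<chi> i j. (mat x - IA A) $ Some i $ Some j) = mat x - diag_plus_i (\<lambda>_. 1) (Aplus A)"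
      by (auto simp: vec_eq_iff mat_def IA_def In_mat_def diag_plus_i_def Aplus_def)
    have "poly (charpoly (IA A)) x =
        (mat x - IA A) $ None $ None * det (mat x - diag_plus_i (\<lambda>_. 1) (Aplus A))"
      unfolding poly_charpoly minor[symmetric]
      by (rule det_option_block) (simp add: mat_def IA_def In_mat_def zero)
    also have "\<dots> = (x - s None) * (\<Prod>i\<in>UNIV. (x - s (Some i)))"
      unfolding poly_charpoly[symmetric] \<mu>(2) poly_prod
      by (simp add: s_def mat_def IA_def In_mat_def algebra_simps)
    also have "\<dots> = poly (\<Prod>k\<in>UNIV. [:- s k, 1:]) x"
      by (simp add: poly_prod UNIV_option_conv prod.reindex left_diff_distrib)
    finally show ?thesis .
  qed
  then have "charpoly (IA A) = (\<Prod>k\<in>UNIV. [:- s k, 1:])"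
    using poly_eq_poly_eq_iff by blast
  then have "spectral_sum f (IA A) = (\<Sum>k\<in>UNIV. f (s k))"
    by (rule spectral_sum_eq)
  also have "\<dots> = f (\<i> * of_real (A $ None $ None)) + c * (\<Sum>i\<in>UNIV. arctan (\<mu> i))"
    by (simp add: UNIV_option_conv sum.reindex s_def f sum_distrib_left)
  also have "(\<Sum>i\<in>UNIV. arctan (\<mu> i)) = tr_arctan (Aplus A)"
    using spectral_sum_eq[OF \<mu>(1), of arctan] by (simp add: spectral_sum_def tr_arctan_def)
  finally show ?thesis .
qed

section \<open>The angle functions\<close>

lemma Arg_one_plus_i: "Arg (1 + \<i> * of_real y) = arctan y"
proof (rule Arg_unique')
  show "0 < 1 / cos (arctan y)" by (simp add: cos_arctan add_pos_nonneg)
  show "arctan y \<in> {- pi<..pi}"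
    using arctan_lbound[of y] arctan_ubound[of y] by auto
  show "1 + \<i> * of_real y = rcis (1 / cos (arctan y)) (arctan y)"
    using tan_arctan[of y] by (simp add: complex_eq_iff tan_def)
qed

text \<open>On \<open>S_set\<close> the eigenvalue 0 of the split-off block contributes
  \<open>pi / 2\<close>; elsewhere 0 is not an eigenvalue and its assigned value is never seen. The
  sign \<open>c = 1\<close> gives \<open>Theta_tilde\<close>, and \<open>c = - 1\<close> gives the
  negative of \<open>Theta_tilde_low\<close>.\<close>

lemma spectral_sum_IA:
  assumes A: "A \<in> sym_mats"
  shows "spectral_sum (\<lambda>z. if z = 0 then pi / 2 else c * Arg z) (IA A) =
    (if A \<in> S_set then pi / 2 + c * tr_arctan (Aplus A) else c * Theta_hat A)"
    (is "spectral_sum ?g _ = _")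
proof (cases "A \<in> S_set")
  case True
  have "1 + \<i> * complex_of_real y \<noteq> 0" for y by (simp add: complex_eq_iff)
  then have "spectral_sum ?g (IA A) = ?g (\<i> * of_real (A $ None $ None)) + c * tr_arctan (Aplus A)"
    using True by (intro spectral_sum_IA_block[OF A]) (auto simp: S_set_def Arg_one_plus_i)
  then show ?thesis using True by (simp add: S_set_def)
next
  case False
  then have "spectral_sum ?g (IA A) = c * Theta_hat A"
    unfolding spectral_sum_def Theta_hat_def sum_distrib_left
    by (intro sum.cong refl) (use charpoly_IA_root(2)[OF A] in \<open>auto simp: mult_ac\<close>)
  then show ?thesis using False by simp
qed

lemma continuous_on_IA: "continuous_on U IA"
  unfolding IA_def by (intro continuous_intros)

lemma usc_on_extension:
  assumes c: "c = 1 \<or> c = - 1"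
  shows "usc_on sym_mats (\<lambda>A. if A \<in> S_set then pi / 2 + c * tr_arctan (Aplus A) else c * Theta_hat A)"
proof -
  let ?g = "\<lambda>z. if z = 0 then pi / 2 else c * Arg z"
  have "usc_on sym_mats (\<lambda>A. spectral_sum ?g (IA A))"
    by (rule usc_on_spectral_sum[OF usc_on_Arg[OF c] continuous_on_IA])
      (auto dest: charpoly_IA_root(1))
  then show ?thesis
    by (rule usc_on_cong[THEN iffD1, rotated]) (rule spectral_sum_IA)
qed

lemma extension_le_usc:
  assumes c: "c = 1 \<or> c = - 1" and g: "usc_on sym_mats g"
    and ext: "\<And>B. B \<in> sym_mats - S_set \<Longrightarrow> g B = c * Theta_hat B" and A: "A \<in> S_set"
  shows "pi / 2 + c * tr_arctan (Aplus A) \<le> g A"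
proof (rule ccontr)
  assume "\<not> ?thesis"
  then have less: "g A < pi / 2 + c * tr_arctan (Aplus A)" by simp
  have A': "A \<in> sym_mats" using A by (simp add: S_set_def)
  \<comment> \<open>The sign \<open>c\<close> places the moved eigenvalue on the half of the
    imaginary axis where \<open>c * Arg\<close> equals \<open>pi / 2\<close>.\<close>
  define X where "X k = (\<chi> i j. if i = None \<and> j = None then c * inverse (real (Suc k)) else A $ i $ j)"
    for k
  have "(\<lambda>k. X k $ i $ j) \<longlonglongrightarrow> A $ i $ j" for i j
  proof (cases "i = None \<and> j = None")
    case True
    have "(\<lambda>k. c * inverse (real (Suc k))) \<longlonglongrightarrow> c * 0"
      by (intro tendsto_mult tendsto_const LIMSEQ_inverse_real_of_nat)
    then show ?thesis using True A by (simp add: X_def S_set_def)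
  next
    case False
    then have "X k $ i $ j = A $ i $ j" for k by (auto simp: X_def)
    then show ?thesis by simp
  qed
  then have X_lim: "X \<longlonglongrightarrow> A" by (intro vec_tendstoI)
  have X_sym: "X k \<in> sym_mats" for k
    using sym_mats_nth[OF A'] by (auto simp: sym_mats_def transpose_def vec_eq_iff X_def)
  have X_None: "X k $ None $ None = c * inverse (real (Suc k))" for k
    by (simp add: X_def)
  have X_nz: "X k $ None $ None \<noteq> 0" for k
    using c by (auto simp: X_None simp del: of_nat_Suc)
  then have X_S: "X k \<notin> S_set" for k
    by (auto simp: S_set_def)
  have X_plus: "Aplus (X k) = Aplus A" for k
    by (simp add: Aplus_def X_def vec_eq_iff)
  \<comment> \<open>Thus \<open>g\<close> is constant along the sequence, and semicontinuity forbids
    a smaller value at the limit \<open>A\<close>. The factors \<open>c\<close> cancel because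
    \<open>c * c = 1\<close>.\<close>
  have "g (X k) = pi / 2 + c * tr_arctan (Aplus A)" for k
  proof -
    have "Arg (\<i> * of_real (X k $ None $ None)) = c * (pi / 2)"
      using c
    proof
      assume "c = 1"
      then show ?thesis by (simp add: X_None Arg_times_of_real2 del: of_real_inverse of_nat_Suc)
    next
      assume "c = - 1"
      then have "\<i> * of_real (X k $ None $ None) = (- \<i>) * of_real (inverse (real (Suc k)))"
        by (simp add: X_None)
      then show ?thesis
        using \<open>c = - 1\<close> Arg_times_of_real2[of "inverse (real (Suc k))" "- \<i>"] by simp
    qed
    moreover have "Theta_hat (X k) = Arg (\<i> * of_real (X k $ None $ None)) + 1 * tr_arctan (Aplus (X k))"
      unfolding Theta_hat_def spectral_sum_def[symmetric]
      using A by (intro spectral_sum_IA_block X_sym) (auto simp: X_def S_set_def Arg_one_plus_i)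
    moreover have "g (X k) = c * Theta_hat (X k)"
      using X_sym X_S ext by blast
    ultimately show ?thesis using c by (auto simp: X_plus)
  qed
  moreover have "\<forall>\<^sub>F k in sequentially. g (X k) < pi / 2 + c * tr_arctan (Aplus A)"
    by (rule usc_on_eventually_sequentially[OF g A' less X_lim X_sym])
  ultimately show False by simp
qed

section \<open>The determinant of \<open>IA A\<close> and differentiability of
  \<open>Theta_hat\<close>\<close>

lemma det_eq_prod_roots:
  fixes M :: "'a::idom^'m^'m"
  assumes "charpoly M = (\<Prod>i\<in>(UNIV::'m set). [:- r i, 1:])"
  shows "det M = (\<Prod>i\<in>UNIV. r i)"
proof -
  have "- M = (\<chi> i. (- 1) *s (M $ i))"
    by (simp add: vec_eq_iff)
  then have "det (- M) = (- 1) ^ CARD('m) * det M"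
    by (simp only: det_rows_mul) simp
  moreover have "det (- M) = poly (charpoly M) 0"
    by (simp add: poly_charpoly mat_def vec_eq_iff flip: zero_vec_def)
  moreover have "\<dots> = (\<Prod>i\<in>UNIV. (- 1) * r i)"
    by (simp add: assms poly_prod)
  ultimately show ?thesis
    by (simp only: prod.distrib) simp
qed

text \<open>Multiply the polar forms of the eigenvalues: the moduli multiply and the arguments add
  up to \<open>Theta_hat A\<close>.\<close>

lemma det_IA_polar:
  assumes A: "A \<in> sym_mats - S_set"
  shows "det (IA A) \<noteq> 0"
    and "det (IA A) = of_real (norm (det (IA A))) * exp (\<i> * of_real (Theta_hat A))"
proof -
  obtain r :: "'a option \<Rightarrow> complex" where r: "charpoly (IA A) = (\<Prod>i\<in>UNIV. [:- r i, 1:])"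
    using charpoly_splits .
  have nz: "r i \<noteq> 0" for i
    by (rule charpoly_IA_root(2)) (use A in \<open>auto simp: r poly_prod\<close>)
  have det: "det (IA A) = (\<Prod>i\<in>UNIV. r i)"
    by (rule det_eq_prod_roots[OF r])
  then show "det (IA A) \<noteq> 0" using nz by simp
  have Theta: "Theta_hat A = (\<Sum>i\<in>UNIV. Arg (r i))"
    using spectral_sum_eq[OF r, of Arg] by (simp add: Theta_hat_def spectral_sum_def)
  have "(\<Prod>i\<in>UNIV. r i) = (\<Prod>i\<in>UNIV. of_real (norm (r i)) * exp (\<i> * of_real (Arg (r i))))"
    by (intro prod.cong refl Arg_eq nz)
  also have "\<dots> = of_real (norm (\<Prod>i\<in>UNIV. r i)) * exp (\<i> * of_real (Theta_hat A))"
    by (simp add: prod.distrib prod_norm Theta sum_distrib_left exp_sum flip: of_real_prod)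
  finally show "det (IA A) = of_real (norm (det (IA A))) * exp (\<i> * of_real (Theta_hat A))"
    by (simp only: det)
qed

lemma det_IA_differentiable: "(\<lambda>B. det (IA B)) differentiable (at A within U)"
proof -
  have entry: "((\<lambda>B. IA B $ i $ j) has_derivative (\<lambda>H. \<i> * of_real (H $ i $ j))) (at A within U)" for i j
  proof -
    have "((\<lambda>B. B $ i $ j) has_derivative (\<lambda>H. H $ i $ j)) (at A within U)"
      by (intro bounded_linear_imp_has_derivative bounded_linear_compose[OF bounded_linear_vec_nth]
          bounded_linear_vec_nth)
    then show ?thesis
      unfolding IA_def by (auto intro!: derivative_eq_intros)
  qed
  show ?thesis
    unfolding det_def differentiable_def
    by (rule exI, rule has_derivative_sum, rule has_derivative_mult_right, rule has_derivative_prod,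
        rule entry)
qed

lemma eventually_not_in_S_set:
  assumes A: "A \<in> sym_mats - S_set"
  shows "\<forall>\<^sub>F B in at A within U. B \<notin> S_set"
proof -
  \<comment> \<open>By symmetry a nonzero entry can be found in row \<open>None\<close>; it stays
    nonzero nearby.\<close>
  obtain j where j: "A $ None $ j \<noteq> 0"
    using A sym_mats_nth[of A] by (auto simp: S_set_def)
  have "((\<lambda>B. B $ None $ j) \<longlongrightarrow> A $ None $ j) (at A within U)"
    by (intro tendsto_vec_nth tendsto_ident_at)
  then have "\<forall>\<^sub>F B in at A within U. B $ None $ j \<noteq> 0"
    using j by (rule tendsto_imp_eventually_ne)
  then show ?thesis
    by eventually_elim (auto simp: S_set_def)
qed

lemma eventually_Theta_hat_less:
  assumes A: "A \<in> sym_mats - S_set" and c: "c = 1 \<or> c = - 1" and e: "0 < e"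
  shows "\<forall>\<^sub>F B in at A within sym_mats. c * Theta_hat B < c * Theta_hat A + e"
proof -
  have "\<forall>\<^sub>F B in at A within sym_mats.
      (if B \<in> S_set then pi / 2 + c * tr_arctan (Aplus B) else c * Theta_hat B) < c * Theta_hat A + e"
    by (rule usc_on_eventually_at[OF usc_on_extension[OF c]]) (use A e in auto)
  then show ?thesis
    using eventually_not_in_S_set[OF A] by eventually_elim simp
qed

text \<open>\<open>Theta_hat\<close> is an argument of \<open>det (IA A)\<close>, so semicontinuity from both sides pins it down
  locally as one differentiable branch.\<close>

lemma Theta_hat_differentiable:
  fixes A :: "real^('n::finite option)^('n option)"
  assumes A: "A \<in> sym_mats - S_set"
  shows "Theta_hat differentiable (at A within sym_mats)"
proof -
  \<comment> \<open>Dividing by the value at \<open>A\<close> gives \<open>q A = 1\<close>, a point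
    off the branch cut of \<open>Ln\<close>.\<close>
  define q where "q B = det (IA B) / det (IA A)" for B :: "real^('n option)^('n option)"
  have in_sym: "\<forall>\<^sub>F B in at A within sym_mats. B \<in> sym_mats"
    by (simp add: eventually_at_filter)
  \<comment> \<open>The two semicontinuity bounds with \<open>e = pi\<close> keep
    \<open>Theta_hat B - Theta_hat A\<close> strictly between \<open>- pi\<close> and
    \<open>pi\<close>, where an argument of \<open>q B\<close> must be the principal one.\<close>
  have "\<forall>\<^sub>F B in at A within sym_mats. Theta_hat A + Im (Ln (q B)) = Theta_hat B"
    using eventually_Theta_hat_less[OF A disjI1[OF refl] pi_gt_zero]
      eventually_Theta_hat_less[OF A disjI2[OF refl] pi_gt_zero]
      eventually_not_in_S_set[OF A, of sym_mats]
      in_sym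
  proof eventually_elim
    case (elim B)
    then have B: "B \<in> sym_mats - S_set" by simp
    have q_B: "q B = (of_real (norm (det (IA B))) * exp (\<i> * of_real (Theta_hat B))) /
        (of_real (norm (det (IA A))) * exp (\<i> * of_real (Theta_hat A)))"
      unfolding q_def by (intro arg_cong2[where f="(/)"] det_IA_polar(2) A B)
    have "Arg (q B) = Theta_hat B - Theta_hat A"
    proof (rule Arg_unique)
      show "0 < norm (det (IA B)) / norm (det (IA A))"
        using det_IA_polar(1)[OF A] det_IA_polar(1)[OF B] by simp
      show "of_real (norm (det (IA B)) / norm (det (IA A))) * exp (\<i> * of_real (Theta_hat B - Theta_hat A)) = q B"
        unfolding q_B by (simp add: exp_diff right_diff_distrib)
    qed (use elim in auto)
    moreover have "q B \<noteq> 0"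
      using det_IA_polar(1)[OF A] det_IA_polar(1)[OF B] by (simp add: q_def)
    ultimately show ?case by (simp add: Arg_eq_Im_Ln)
  qed
  moreover have "(\<lambda>B. Theta_hat A + Im (Ln (q B))) differentiable (at A within sym_mats)"
  proof -
    obtain E where "((\<lambda>B. det (IA B)) has_derivative E) (at A within sym_mats)"
      using det_IA_differentiable[of A sym_mats] unfolding differentiable_def by blast
    then have D: "(q has_derivative (\<lambda>H. E H / det (IA A))) (at A within sym_mats)"
      unfolding q_def by (rule bounded_linear.has_derivative[OF bounded_linear_divide])
    have "q A = 1" using det_IA_polar(1)[OF A] by (simp add: q_def)
    then have "(Ln has_field_derivative 1) (at (q A))"
      by (auto intro!: derivative_eq_intros)
    then have "(Ln has_derivative (*) 1) (at (q A))"
      by (rule has_field_derivative_imp_has_derivative)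
    from has_derivative_compose[OF D this]
    have "((\<lambda>B. Theta_hat A + Im (Ln (q B))) has_derivative (\<lambda>H. 0 + Im (1 * (E H / det (IA A))))) (at A within sym_mats)"
      by (intro has_derivative_add has_derivative_const has_derivative_Im)
    then show ?thesis unfolding differentiable_def by blast
  qed
  \<comment> \<open>The eventual equality excludes the point \<open>A\<close> itself, so agreement
    there is checked separately.\<close>
  moreover have "Theta_hat A + Im (Ln (q A)) = Theta_hat A"
    using det_IA_polar(1)[OF A] by (simp add: q_def)
  ultimately show ?thesis
    unfolding differentiable_def using A
    by (blast intro: has_derivative_transform_eventually)
qed

theorem theorem3p1:
  fixes nty :: "'n::finite itself"
  shows
  "(\<forall>A :: real^('n option)^('n option). A \<in> sym_mats - S_set \<longrightarrow>
       (\<forall>z. poly (charpoly (IA A)) z = 0 \<longrightarrow> z \<noteq> 0 \<and> Re z \<ge> 0))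
   \<and> (\<forall>A :: real^('n option)^('n option). A \<in> sym_mats - S_set \<longrightarrow>
       Theta_hat differentiable (at A within sym_mats))
   \<and> usc_on (sym_mats :: (real^('n option)^('n option)) set) Theta_tilde
   \<and> (\<forall>A :: real^('n option)^('n option). A \<in> sym_mats - S_set \<longrightarrow> Theta_tilde A = Theta_hat A)
   \<and> (\<forall>g :: real^('n option)^('n option) \<Rightarrow> real.
        usc_on sym_mats g \<and> (\<forall>A \<in> sym_mats - S_set. g A = Theta_hat A) \<longrightarrow>
        (\<forall>A \<in> sym_mats. Theta_tilde A \<le> g A))
   \<and> lsc_on (sym_mats :: (real^('n option)^('n option)) set) Theta_tilde_low
   \<and> (\<forall>A :: real^('n option)^('n option). A \<in> sym_mats - S_set \<longrightarrow> Theta_tilde_low A = Theta_hat A)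
   \<and> (\<forall>g :: real^('n option)^('n option) \<Rightarrow> real.
        lsc_on sym_mats g \<and> (\<forall>A \<in> sym_mats - S_set. g A = Theta_hat A) \<longrightarrow>
        (\<forall>A \<in> sym_mats. g A \<le> Theta_tilde_low A))"
proof -
  have tilde: "Theta_tilde = (\<lambda>A :: real^('n option)^('n option).
      if A \<in> S_set then pi / 2 + 1 * tr_arctan (Aplus A) else 1 * Theta_hat A)"
    by (auto simp: Theta_tilde_def)
  \<comment> \<open>Negation turns the lower extension into the case \<open>c = - 1\<close> of the
    common formula.\<close>
  have tilde_low: "(\<lambda>A. - Theta_tilde_low A) = (\<lambda>A :: real^('n option)^('n option).
      if A \<in> S_set then pi / 2 + (- 1) * tr_arctan (Aplus A) else (- 1) * Theta_hat A)"
    by (auto simp: Theta_tilde_low_def)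
  have min: "Theta_tilde A \<le> g A"
    if "usc_on sym_mats g" "\<forall>A \<in> sym_mats - S_set. g A = Theta_hat A" "A \<in> sym_mats"
    for g and A :: "real^('n option)^('n option)"
    using that extension_le_usc[of 1 g A] by (cases "A \<in> S_set") (auto simp: Theta_tilde_def)
  have max: "g A \<le> Theta_tilde_low A"
    if "lsc_on sym_mats g" "\<forall>A \<in> sym_mats - S_set. g A = Theta_hat A" "A \<in> sym_mats"
    for g and A :: "real^('n option)^('n option)"
    using that extension_le_usc[of "- 1" "\<lambda>A. - g A" A]
    by (cases "A \<in> S_set") (auto simp: Theta_tilde_low_def lsc_on_iff_usc_on_minus)
  show ?thesis
  proof (intro conjI allI impI ballI)
    show "usc_on sym_mats (Theta_tilde :: real^('n option)^('n option) \<Rightarrow> real)"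
      unfolding tilde by (rule usc_on_extension) simp
    show "lsc_on sym_mats (Theta_tilde_low :: real^('n option)^('n option) \<Rightarrow> real)"
      unfolding lsc_on_iff_usc_on_minus tilde_low by (rule usc_on_extension) simp
  next
    fix A :: "real^('n option)^('n option)" and z
    assume A: "A \<in> sym_mats - S_set"
    show "Theta_hat differentiable (at A within sym_mats)"
      using A by (rule Theta_hat_differentiable)
    show "Theta_tilde A = Theta_hat A" "Theta_tilde_low A = Theta_hat A"
      using A by (simp_all add: Theta_tilde_def Theta_tilde_low_def)
    assume "poly (charpoly (IA A)) z = 0"
    with A show "z \<noteq> 0" "0 \<le> Re z"
      using charpoly_IA_root by blast+
  qed (use min max in simp_all)
qed

end
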